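(* Let $U$ be a magnet. There are an integer $n_{\mathbf c}=n_{\mathbf c}(U)\ge n_{\mathbf p}$ and $d_{\mathbf c}=d_{\mathbf c}(U)\in(0,1)$ such that for any proper standard family $\mathcal G$, the covering ratio over $U$ satisfies $\delta(T^{n_{\mathbf c}}\mathcal G)\ge d_{\mathbf c}$.
   Context: **Setting.** $M=[0,1]$ with Lebesgue measure $m$. For a sub-interval $W\subset M$ (of positive length) write $|W|=m(W)$. $T:M\to M$ is a map with a countable partition $\xi_1$ of $M$ into sub-intervals such that $T$ is strictly monotonic and $C^1$ on the interior of each element of $\xi_1$. Put $\xi_n=\bigvee_{k=0}^{n-1}T^{-k}\xi_1$, let $\mathcal S_n$ be the set of endpoints of intervals in $\xi_n$, and $\mathcal S_\infty=\bigcup_{n\ge1}\mathcal S_n$. For an interval $W$, $\{W_\alpha\}_{\alpha\in W/\xi_n}$ is the partition of $W$ into sub-intervals induced by $\xi_n$; the intervals $T^nW_\alpha$ are called the components of $T^nW$. For $x,y\in M\setminus\mathcal S_\infty$, the separation time $\mathbf s(x,y)$ is the smallest integer $n\ge1$ such that $x,y$ lie in distinct elements of $\xi_n$. For an interval $W$ and $\gamma\in(0,1)$, $\mathcal H_{W,\gamma}$ is the space of $f:M\to\mathbb R$ vanishing outside $W$ with $|f|_{W,\gamma}:=\sup\{|f(x)-f(y)|/\gamma^{\mathbf s(x,y)}: x\ne y\in W\setminus\mathcal S_\infty\}<\infty$. **Standing assumptions.** (H1) There is $q\in(0,1]$ with $\liminf_{\delta\to0}\sup_{W:|W|<\delta}\sum_{\alpha\in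 W/\xi_1}\left(\frac{|W|}{|TW_\alpha|}\right)^{q}\frac{|W_\alpha|}{|W|}<1$ (sup over sub-intervals $W\subset M$); this is called one-step expansion at $q$-scale. (H2) There are $C_{\mathbf J}>0$, $\gamma_{\mathbf J}\in(0,1)$ such that for every $W\in\xi_1$, $\mathbf 1_W\log|T'|\in\mathcal H_{W,\gamma_{\mathbf J}}$ with $|\mathbf 1_W\log|T'||_{W,\gamma_{\mathbf J}}\le C_{\mathbf J}$. (H3) There is an interval $U$, called a magnet, such that for any interval $W\subset M$ there is $n_W\ge1$ such that for all $n\ge n_W$ at least one component of $T^nW$ contains $U$. **Standard pairs and families.** Fix $\boldsymbol\gamma\in[\gamma_{\mathbf J},1)$ and $C_{\mathbf r}\ge\max\{1,2C_{\mathbf J}/(\boldsymbol\gamma^{-1}-1)\}$. A pair $(W,\nu)$ is an interval $W\subset M$ with an absolutely continuous probability measure $\nu$ supported on $W$; it is a standard pair if its density $\rho=d\nu/dm$ satisfies $\log\rho\in\mathcal H_{W,\boldsymbol\gamma}$ (on $W$) with $|\log\rho|_{W,\boldsymbol\gamma}\le C_{\mathbf r}$. A family $\mathcal G=\sum_{\alpha\in\mathcal A}\lambda_\alpha(W_\alpha,\nu_\alpha)$ is a countable collection of pairs with weights $\lambda_\alpha\ge0$. It is a standard family if every $(W_\alpha,\nu_\alpha)$ is a standard pair and $\sum_\alpha\lambda_\alpha=1$. **Iterates.** For a pair, $T^n(W,\nu)=\sum_{\alpha\in W/\xi_n}\nu(W_\alpha)\cdot(T^nW_\alpha,\nu_\alpha)$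 with $\nu_\alpha(\cdot)=\nu(T^{-n}(\cdot)\,|\,W_\alpha)$; for a family, $T^n\mathcal G=\sum_\beta\lambda_\beta T^n(W_\beta,\nu_\beta)$ (weights multiplied). **Constants.** Let $\overline q$ be the supremum of $q\in(0,1]$ for which the one-step expansion holds at $q$-scale. Fix $q_0\in(0,\overline q)$ and $\delta_0>0$ such that $\theta_0:=\sup_{W:|W|<\delta_0}\sum_{\alpha\in W/\xi_1}\left(\frac{|W|}{|TW_\alpha|}\right)^{q_0}\frac{|W_\alpha|}{|W|}<1$. Put $\mathcal Z(\mathcal G)=\sum_\alpha\lambda_\alpha|W_\alpha|^{-q_0}$, $c_0=\max\{1,2\theta_0\delta_0^{-q_0}/(1-\theta_0)\}$, and fix $C_{\mathbf p}\ge10c_0e^{7C_{\mathbf r}}$. A family is proper if $\mathcal Z(\mathcal G)\le C_{\mathbf p}$. Put $n_{\mathbf p}:=\lfloor -\log C_{\mathbf p}/\log\theta_0\rfloor+1$. **Covering ratio.** For a family $\mathcal G=\sum_{\alpha\in\mathcal A}\lambda_\alpha(W_\alpha,\nu_\alpha)$, $\delta(\mathcal G)=\sum_{\alpha\in\mathcal A:\ W_\alpha\supset U}\lambda_\alpha$. *)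

theory Defs
  imports "HOL-Probability.Probability"
begin

abbreviation len :: "real set \<Rightarrow> real" where
  "len W \<equiv> measure lborel W"

definition subinterval :: "real set \<Rightarrow> bool" where
  "subinterval W \<longleftrightarrow> W \<subseteq> {0..1} \<and> is_interval W \<and> 0 < len W"

(* The value of T outside {0..1} is irrelevant.  Elements of xi may be single points, as is needed
   e.g. for the point 0 in the Gauss map; nothing is required of T at the endpoints of the
   elements. *)
definition piecewise_monotone_map :: "(real \<Rightarrow> real) \<Rightarrow> real set set \<Rightarrow> bool" where
  "piecewise_monotone_map T xi \<longleftrightarrow>
     T \<in> {0..1} \<rightarrow> {0..1} \<and> partition_on {0..1} xi \<and> countable xi \<and>
     (\<forall>A\<in>xi. is_interval A \<and>
        (strict_mono_on (interior A) T \<or> strict_antimono_on (interior A) T) \<and>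
        T C1_differentiable_on (interior A))"


(* The join of the partitions T^{-k} xi for k < n.  Since T is arbitrary at endpoints, an element is
   in general an interval together with finitely many isolated points. *)
definition xi_join :: "(real \<Rightarrow> real) \<Rightarrow> real set set \<Rightarrow> nat \<Rightarrow> real set set" where
  "xi_join T xi n =
     {C. C \<noteq> {} \<and> (\<exists>A. (\<forall>k<n. A k \<in> xi) \<and> C = {x\<in>{0..1}. \<forall>k<n. (T ^^ k) x \<in> A k})}"

(* The frontier of an interval is the set of its endpoints. *)
definition S_inf :: "(real \<Rightarrow> real) \<Rightarrow> real set set \<Rightarrow> real set" where
  "S_inf T xi = (\<Union>n\<in>{1..}. \<Union>A\<in>xi_join T xi n. frontier A)"

(* Pieces of length zero are discarded; they have measure zero and carry no weight. *)
definition pieces :: "(real \<Rightarrow> real) \<Rightarrow> real set set \<Rightarrow> nat \<Rightarrow> real set \<Rightarrow> real set set" where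
  "pieces T xi n W = {W \<inter> A | A. A \<in> xi_join T xi n \<and> 0 < len (W \<inter> A)}"

definition separation_time :: "(real \<Rightarrow> real) \<Rightarrow> real set set \<Rightarrow> real \<Rightarrow> real \<Rightarrow> enat" where
  "separation_time T xi x y =
     (INF n\<in>{n. 1 \<le> n \<and> \<not> (\<exists>A\<in>xi_join T xi n. x \<in> A \<and> y \<in> A)}. enat n)"

definition power_enat :: "real \<Rightarrow> enat \<Rightarrow> ennreal" where
  "power_enat g s = (case s of enat n \<Rightarrow> ennreal (g ^ n) | \<infinity> \<Rightarrow> 0)"

(* In ennreal, 0 / 0 = 0 and a / 0 = \<infinity> for a > 0: points that are never separated must have equal
   values for the seminorm to be finite. *)
definition hoelder_seminorm ::
  "(real \<Rightarrow> real) \<Rightarrow> real set set \<Rightarrow> real set \<Rightarrow> real \<Rightarrow> (real \<Rightarrow> real) \<Rightarrow> ennreal" where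
  "hoelder_seminorm T xi W g f =
     (SUP (x, y) \<in> {(x, y). x \<in> W - S_inf T xi \<and> y \<in> W - S_inf T xi \<and> x \<noteq> y}.
        ennreal \<bar>f x - f y\<bar> / power_enat g (separation_time T xi x y))"

definition hoelder_space ::
  "(real \<Rightarrow> real) \<Rightarrow> real set set \<Rightarrow> real set \<Rightarrow> real \<Rightarrow> (real \<Rightarrow> real) set" where
  "hoelder_space T xi W g = {f. (\<forall>x. x \<notin> W \<longrightarrow> f x = 0) \<and> hoelder_seminorm T xi W g f < \<infinity>}"


definition expansion_sum ::
  "(real \<Rightarrow> real) \<Rightarrow> real set set \<Rightarrow> real \<Rightarrow> real set \<Rightarrow> ennreal" where
  "expansion_sum T xi q W =
     (\<Sum>\<^sub>\<infinity>V\<in>pieces T xi 1 W. ennreal ((len W / len (T ` V)) powr q * (len V / len W)))"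

definition expansion_sup ::
  "(real \<Rightarrow> real) \<Rightarrow> real set set \<Rightarrow> real \<Rightarrow> real \<Rightarrow> ennreal" where
  "expansion_sup T xi q \<delta> = (SUP W\<in>{W. subinterval W \<and> len W < \<delta>}. expansion_sum T xi q W)"

definition one_step_expansion :: "(real \<Rightarrow> real) \<Rightarrow> real set set \<Rightarrow> real \<Rightarrow> bool" where
  "one_step_expansion T xi q \<longleftrightarrow> Liminf (at_right 0) (expansion_sup T xi q) < 1"

(* The condition deriv T x \<noteq> 0 says that log |T'| is real-valued (in HOL, ln 0 = 0). *)
definition regular_log_derivative ::
  "(real \<Rightarrow> real) \<Rightarrow> real set set \<Rightarrow> real \<Rightarrow> real \<Rightarrow> bool" where
  "regular_log_derivative T xi CJ gJ \<longleftrightarrow>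
     0 < CJ \<and> 0 < gJ \<and> gJ < 1 \<and>
     (\<forall>W\<in>xi. (\<forall>x\<in>interior W. deriv T x \<noteq> 0) \<and>
        (\<lambda>x. indicator W x * ln \<bar>deriv T x\<bar>) \<in> hoelder_space T xi W gJ \<and>
        hoelder_seminorm T xi W gJ (\<lambda>x. indicator W x * ln \<bar>deriv T x\<bar>) \<le> ennreal CJ)"

definition magnet :: "(real \<Rightarrow> real) \<Rightarrow> real set set \<Rightarrow> real set \<Rightarrow> bool" where
  "magnet T xi U \<longleftrightarrow> subinterval U \<and>
     (\<forall>W. subinterval W \<longrightarrow>
        (\<exists>nW\<ge>1. \<forall>n\<ge>nW. \<exists>V\<in>pieces T xi n W. U \<subseteq> (T ^^ n) ` V))"


definition is_pair :: "real set \<Rightarrow> real measure \<Rightarrow> bool" where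
  "is_pair W \<nu> \<longleftrightarrow> subinterval W \<and> prob_space \<nu> \<and> sets \<nu> = sets borel \<and>
     absolutely_continuous lborel \<nu> \<and> emeasure \<nu> (- W) = 0"

(* The density is only determined almost everywhere: some version has to be regular. *)
definition standard_pair ::
  "(real \<Rightarrow> real) \<Rightarrow> real set set \<Rightarrow> real \<Rightarrow> real \<Rightarrow> real set \<Rightarrow> real measure \<Rightarrow> bool" where
  "standard_pair T xi g Cr W \<nu> \<longleftrightarrow> is_pair W \<nu> \<and>
     (\<exists>\<rho>\<in>borel_measurable borel.
        \<nu> = density lborel (\<lambda>x. ennreal (\<rho> x)) \<and> (\<forall>x. 0 \<le> \<rho> x) \<and> (\<forall>x\<in>W. 0 < \<rho> x) \<and>
        (\<lambda>x. indicator W x * ln (\<rho> x)) \<in> hoelder_space T xi W g \<and>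
        hoelder_seminorm T xi W g (\<lambda>x. indicator W x * ln (\<rho> x)) \<le> ennreal Cr)"

record 'i family =
  fam_index :: "'i set"
  fam_weight :: "'i \<Rightarrow> real"
  fam_interval :: "'i \<Rightarrow> real set"
  fam_measure :: "'i \<Rightarrow> real measure"

definition standard_family ::
  "(real \<Rightarrow> real) \<Rightarrow> real set set \<Rightarrow> real \<Rightarrow> real \<Rightarrow> 'i family \<Rightarrow> bool" where
  "standard_family T xi g Cr G \<longleftrightarrow> countable (fam_index G) \<and>
     (\<forall>i\<in>fam_index G. 0 \<le> fam_weight G i \<and>
        standard_pair T xi g Cr (fam_interval G i) (fam_measure G i)) \<and>
     (fam_weight G has_sum 1) (fam_index G)"

(* The measure E \<mapsto> \<nu>(T^{-n} E | V).  The restriction to V makes this independent of T outside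
   {0..1}. *)
definition image_measure ::
  "(real \<Rightarrow> real) \<Rightarrow> nat \<Rightarrow> real measure \<Rightarrow> real set \<Rightarrow> real measure" where
  "image_measure T n \<nu> V = distr (uniform_measure (restrict_space \<nu> V) V) borel (T ^^ n)"

definition iterate_family ::
  "(real \<Rightarrow> real) \<Rightarrow> real set set \<Rightarrow> nat \<Rightarrow> 'i family \<Rightarrow> ('i \<times> real set) family" where
  "iterate_family T xi n G =
     \<lparr> fam_index = (SIGMA i:fam_index G. pieces T xi n (fam_interval G i)),
       fam_weight = (\<lambda>(i, V). fam_weight G i * measure (fam_measure G i) V),
       fam_interval = (\<lambda>(i, V). (T ^^ n) ` V),
       fam_measure = (\<lambda>(i, V). image_measure T n (fam_measure G i) V) \<rparr>"

definition Z_family :: "real \<Rightarrow> 'i family \<Rightarrow> ennreal" where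
  "Z_family q0 G =
     (\<Sum>\<^sub>\<infinity>i\<in>fam_index G. ennreal (fam_weight G i * len (fam_interval G i) powr (- q0)))"

definition proper_family :: "real \<Rightarrow> real \<Rightarrow> 'i family \<Rightarrow> bool" where
  "proper_family q0 Cp G \<longleftrightarrow> Z_family q0 G \<le> ennreal Cp"

definition covering_ratio :: "real set \<Rightarrow> 'i family \<Rightarrow> real" where
  "covering_ratio U G =
     (\<Sum>\<^sub>\<infinity>i\<in>{i\<in>fam_index G. U \<subseteq> fam_interval G i}. fam_weight G i)"


definition q_bar :: "(real \<Rightarrow> real) \<Rightarrow> real set set \<Rightarrow> real" where
  "q_bar T xi = Sup {q\<in>{0<..1}. one_step_expansion T xi q}"

definition theta0 :: "(real \<Rightarrow> real) \<Rightarrow> real set set \<Rightarrow> real \<Rightarrow> real \<Rightarrow> real" where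
  "theta0 T xi q0 \<delta>0 = enn2real (expansion_sup T xi q0 \<delta>0)"

definition c0 :: "(real \<Rightarrow> real) \<Rightarrow> real set set \<Rightarrow> real \<Rightarrow> real \<Rightarrow> real" where
  "c0 T xi q0 \<delta>0 =
     max 1 (2 * theta0 T xi q0 \<delta>0 * \<delta>0 powr (- q0) / (1 - theta0 T xi q0 \<delta>0))"

definition n_p :: "(real \<Rightarrow> real) \<Rightarrow> real set set \<Rightarrow> real \<Rightarrow> real \<Rightarrow> real \<Rightarrow> int" where
  "n_p T xi q0 \<delta>0 Cp = \<lfloor>- ln Cp / ln (theta0 T xi q0 \<delta>0)\<rfloor> + 1"

end

theory Submission
  imports Defs
begin

text \<open>
  Markov's inequality applied to \<open>Z_family q0 G \<le> Cp\<close> shows that in every proper standard family at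
  least half of the weight is carried by intervals of length at least
  \<open>\<epsilon> = (2 * Cp) powr (- 1 / q0)\<close> (\<open>half_weight_long\<close>).
  The number \<open>\<epsilon>\<close> does not depend on the family, and every interval of length at least \<open>\<epsilon>\<close> contains
  one of the \<open>N\<close> cells of a fixed grid of mesh \<open>1/N < \<epsilon>/2\<close> (\<open>interval_contains_grid_cell\<close>).

  Since the cells are finitely many, the magnet property yields one time \<open>n\<close>, as large as desired,
  at which every cell \<open>I\<^sub>j\<close> has a piece \<open>V\<^sub>j\<close> of positive length with \<open>U \<subseteq> T\<^sup>n V\<^sub>j\<close>.  If \<open>I\<^sub>j \<subseteq> W\<close>, then
  \<open>V\<^sub>j\<close> lies in a piece of \<open>W\<close> (\<open>piece_superset\<close>), whose image therefore contains \<open>U\<close> too.  The density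
  of a standard pair oscillates by at most the factor \<open>exp Cr\<close> off a null set and has mean at least 1
  over \<open>W\<close>, so that piece has mass at least \<open>exp (- Cr) |V\<^sub>j|\<close> (\<open>standard_pair_measure_ge\<close>).  The covering ratio at time
  \<open>n\<close> is thus at least \<open>exp (- Cr) min\<^sub>j |V\<^sub>j| / 2\<close>.

  The oscillation bound holds only outside \<open>S_inf\<close>, so that set has to be null.  It is countable,
  because the elements of the joined partitions are countably many and each of them is the union of
  an interval and a finite set.
\<close>

section \<open>Elements of the joined partitions\<close>

text \<open>
  Intervals up to finitely many additional points.  The additional points are needed because the map
  is arbitrary at the endpoints of the elements of the partition.
\<close>
definition almost_interval :: "real set \<Rightarrow> bool" where
  "almost_interval C \<longleftrightarrow> (\<exists>I F. is_interval I \<and> finite F \<and> C = I \<union> F)"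

lemma almost_interval_interval: "is_interval I \<Longrightarrow> almost_interval I"
  unfolding almost_interval_def by (metis finite.emptyI sup_bot_right)

lemma almost_interval_Un_finite:
  assumes "almost_interval C" "finite F"
  shows "almost_interval (C \<union> F)"
  using assms unfolding almost_interval_def by (metis finite_Un sup_assoc)

lemma almost_interval_borel: "almost_interval C \<Longrightarrow> C \<in> sets borel"
  unfolding almost_interval_def
  by (metis borel_closed finite_imp_closed real_interval_borel_measurable sets.Un)

lemma finite_frontier_interval:
  fixes I :: "real set"
  assumes "is_interval I"
  shows "finite (frontier I)"
proof -
  obtain a b where "I = {} \<or> I = UNIV \<or> I = {..<b} \<or> I = {..b} \<or> I = {a<..} \<or> I = {a..} \<or>
      I = {a<..<b} \<or> I = {a<..b} \<or> I = {a..<b} \<or> I = {a..b}"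
    using is_real_interval[OF assms] by blast
  then have "frontier I \<subseteq> {a, b}"
    by (cases "a < b") (auto simp: frontier_def interior_open)
  then show ?thesis
    by (rule finite_subset) simp
qed

lemma finite_frontier_almost_interval:
  assumes "almost_interval C"
  shows "finite (frontier C)"
proof -
  obtain I F where IF: "is_interval I" "finite F" "C = I \<union> F"
    using assms unfolding almost_interval_def by blast
  have "frontier F \<subseteq> F"
    using IF(2) by (simp add: frontier_subset_closed finite_imp_closed)
  then have "frontier C \<subseteq> frontier I \<union> F"
    using frontier_Un_subset[of I F] IF(3) by blast
  then show ?thesis
    using finite_frontier_interval[OF IF(1)] IF(2) finite_subset by blast
qed

lemma almost_interval_restricted_preimage:
  assumes J: "is_interval J"
    and mono: "strict_mono_on J f \<or> strict_antimono_on J f"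
    and C: "almost_interval C"
  shows "almost_interval {x \<in> J. f x \<in> C}"
proof -
  obtain I F where IF: "is_interval I" "finite F" "C = I \<union> F"
    using C unfolding almost_interval_def by blast
  have "is_interval {x \<in> J. f x \<in> I}"
    unfolding is_interval_1
  proof (intro ballI allI impI)
    fix a b x
    assume a: "a \<in> {x \<in> J. f x \<in> I}" and b: "b \<in> {x \<in> J. f x \<in> I}" and x: "a \<le> x \<and> x \<le> b"
    then have xJ: "x \<in> J"
      using J unfolding is_interval_1 by blast
    have "(f a \<le> f x \<and> f x \<le> f b) \<or> (f b \<le> f x \<and> f x \<le> f a)"
      using mono
    proof
      assume "strict_mono_on J f"
      then have "mono_on J f" by (rule strict_mono_on_imp_mono_on)
      then show ?thesis using a b x xJ unfolding monotone_on_def by auto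
    next
      assume "strict_antimono_on J f"
      then have "x < y \<Longrightarrow> f y < f x" if "x \<in> J" "y \<in> J" for x y
        using that unfolding monotone_on_def by auto
      then have "x \<le> y \<Longrightarrow> f y \<le> f x" if "x \<in> J" "y \<in> J" for x y
        using that by (metis order.order_iff_strict)
      then show ?thesis using a b x xJ by auto
    qed
    then have "f x \<in> I"
      using IF(1) a b unfolding is_interval_1 by blast
    then show "x \<in> {x \<in> J. f x \<in> I}" using xJ by blast
  qed
  moreover have "inj_on f J"
    using mono by (auto simp: monotone_on_def inj_on_def) (metis less_irrefl linorder_neqE)+
  then have "finite (f -` F \<inter> J)"
    using IF(2) by (rule finite_vimage_IntI[rotated])
  moreover have "{x \<in> J. f x \<in> C} = {x \<in> J. f x \<in> I} \<union> (f -` F \<inter> J)"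
    using IF(3) by blast
  ultimately show ?thesis
    unfolding almost_interval_def by blast
qed

text \<open>
  Induction on the length: a cylinder is the set of points of \<open>A 0\<close> that are mapped into a cylinder
  of length \<open>n\<close>.  The map is strictly monotonic on the interior of \<open>A 0\<close>, and the remaining points of
  \<open>A 0\<close> are finitely many.
\<close>
lemma almost_interval_cylinder:
  assumes map: "piecewise_monotone_map T xi"
    and "\<forall>k<n. A k \<in> xi"
  shows "almost_interval {x \<in> {0..1}. \<forall>k<n. (T ^^ k) x \<in> A k}"
  using assms(2)
proof (induction n arbitrary: A)
  case 0
  have "{x \<in> {0..1}. \<forall>k<0. (T ^^ k) x \<in> A k} = {0..1}" by auto
  then show ?case using almost_interval_interval is_interval_cc by metis
next
  case (Suc n)
  define C where "C = {x \<in> {0..1}. \<forall>k<n. (T ^^ k) x \<in> A (Suc k)}"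
  have T01: "T x \<in> {0..1}" if "x \<in> {0..1}" for x
    using map that unfolding piecewise_monotone_map_def by blast
  have A0: "A 0 \<in> xi" using Suc.prems by blast
  then have A01: "A 0 \<subseteq> {0..1}" and int: "is_interval (A 0)"
    and mono: "strict_mono_on (interior (A 0)) T \<or> strict_antimono_on (interior (A 0)) T"
    using map unfolding piecewise_monotone_map_def partition_on_def by blast+
  have "almost_interval C"
    unfolding C_def using Suc.IH[of "\<lambda>k. A (Suc k)"] Suc.prems by simp
  moreover have "is_interval (interior (A 0))"
    using int by (simp add: is_interval_convex_1)
  ultimately have "almost_interval {x \<in> interior (A 0). T x \<in> C}"
    using almost_interval_restricted_preimage mono by blast
  moreover have "finite (A 0 - interior (A 0))"
    using finite_frontier_interval[OF int] closure_subset
    by (metis Diff_mono finite_subset frontier_def order_refl)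
  then have "finite {x \<in> A 0 - interior (A 0). T x \<in> C}"
    by (rule rev_finite_subset) blast
  ultimately have "almost_interval ({x \<in> interior (A 0). T x \<in> C} \<union>
      {x \<in> A 0 - interior (A 0). T x \<in> C})"
    by (rule almost_interval_Un_finite)
  also have "\<dots> = {x \<in> A 0. T x \<in> C}"
    using interior_subset by blast
  also have "\<dots> = {x \<in> {0..1}. \<forall>k<Suc n. (T ^^ k) x \<in> A k}"
    unfolding C_def All_less_Suc2 using A01 T01 by (auto simp: funpow_swap1)
  finally show ?case .
qed

lemma almost_interval_xi_join:
  assumes "piecewise_monotone_map T xi" "C \<in> xi_join T xi n"
  shows "almost_interval C"
  using assms almost_interval_cylinder unfolding xi_join_def by blast

lemma countable_xi_join:
  assumes "countable xi"
  shows "countable (xi_join T xi n)"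
proof -
  let ?cyl = "\<lambda>A. {x\<in>{0..1}. \<forall>k<n. (T ^^ k) x \<in> A k}"
  have "xi_join T xi n \<subseteq> ?cyl ` ({..<n} \<rightarrow>\<^sub>E xi)"
  proof
    fix C assume "C \<in> xi_join T xi n"
    then obtain A where A: "\<forall>k<n. A k \<in> xi" "C = ?cyl A"
      unfolding xi_join_def by blast
    have "?cyl A = ?cyl (restrict A {..<n})" by auto
    moreover have "restrict A {..<n} \<in> {..<n} \<rightarrow>\<^sub>E xi" using A(1) by auto
    ultimately show "C \<in> ?cyl ` ({..<n} \<rightarrow>\<^sub>E xi)" using A(2) by blast
  qed
  moreover have "countable ({..<n} \<rightarrow>\<^sub>E xi)"
    using assms by (intro countable_PiE) auto
  ultimately show ?thesis
    by (meson countable_image countable_subset)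
qed

lemma countable_S_inf:
  assumes "piecewise_monotone_map T xi"
  shows "countable (S_inf T xi)"
  unfolding S_inf_def
  using assms almost_interval_xi_join finite_frontier_almost_interval countable_xi_join
  by (intro countable_UN) (auto intro: countable_finite simp: piecewise_monotone_map_def)

lemma disjoint_xi_join:
  assumes "disjoint xi"
  shows "disjoint (xi_join T xi n)"
proof (rule disjointI)
  fix C D assume CD: "C \<in> xi_join T xi n" "D \<in> xi_join T xi n" "C \<noteq> D"
  obtain A where A: "\<forall>k<n. A k \<in> xi" "C = {x\<in>{0..1}. \<forall>k<n. (T ^^ k) x \<in> A k}"
    using CD(1) unfolding xi_join_def by blast
  obtain B where B: "\<forall>k<n. B k \<in> xi" "D = {x\<in>{0..1}. \<forall>k<n. (T ^^ k) x \<in> B k}"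
    using CD(2) unfolding xi_join_def by blast
  show "C \<inter> D = {}"
  proof (rule ccontr)
    assume "C \<inter> D \<noteq> {}"
    then obtain x where x: "x \<in> C" "x \<in> D" by blast
    have "A k = B k" if "k < n" for k
      using that x A B disjointD[OF assms, of "A k" "B k"] by blast
    then have "C = D" using A(2) B(2) by auto
    then show False using CD(3) by blast
  qed
qed

lemma disjoint_pieces:
  assumes "disjoint xi"
  shows "disjoint (pieces T xi n W)"
  using disjoint_xi_join[OF assms, of T n] unfolding pieces_def disjoint_def by blast

lemma pieces_borel:
  assumes "piecewise_monotone_map T xi" "is_interval W" "V \<in> pieces T xi n W"
  shows "V \<in> sets borel"
  using assms almost_interval_borel almost_interval_xi_join real_interval_borel_measurable
  unfolding pieces_def by blast

section \<open>Standard pairs\<close>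

lemma subinterval_emeasure:
  assumes "subinterval W"
  shows "emeasure lborel W = ennreal (len W)" "len W \<le> 1"
proof -
  have W: "W \<subseteq> {0..1}" using assms unfolding subinterval_def by blast
  have "emeasure lborel W \<le> emeasure lborel {0..1::real}"
    by (rule emeasure_mono[OF W]) simp
  then have le: "emeasure lborel W \<le> 1" by simp
  then show eq: "emeasure lborel W = ennreal (len W)"
    by (intro emeasure_eq_ennreal_measure) (auto simp: top_unique)
  show "len W \<le> 1" using le unfolding eq by simp
qed

lemma power_enat_le_1:
  assumes "0 \<le> g" "g \<le> 1"
  shows "power_enat g s \<le> 1"
  using assms by (auto simp: power_enat_def power_le_one split: enat.split)

text \<open>The case \<open>p = 0\<close> is included: then the quotient is 0 if \<open>a = 0\<close> and \<open>\<infinity>\<close> otherwise.\<close>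
lemma ennreal_le_divide:
  assumes "p \<le> 1" "0 \<le> a"
  shows "ennreal a \<le> ennreal a / p"
proof (cases p)
  case (real r)
  then have "r \<le> 1" using assms(1) by simp
  show ?thesis
  proof (cases "r = 0")
    case True
    then show ?thesis using real by simp
  next
    case False
    then have "ennreal a / p = ennreal (a / r)"
      using real assms(2) by (simp add: divide_ennreal)
    moreover have "a \<le> a / r"
      using False real \<open>r \<le> 1\<close> assms(2) by (simp add: field_simps mult_left_le)
    ultimately show ?thesis by (simp add: ennreal_leI)
  qed
qed (use assms in \<open>simp add: top_unique\<close>)

lemma hoelder_seminorm_oscillation:
  assumes g: "0 \<le> g" "g \<le> 1" and C: "0 \<le> C"
    and f: "hoelder_seminorm T xi W g f \<le> ennreal C"
    and x: "x \<in> W - S_inf T xi" and y: "y \<in> W - S_inf T xi"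
  shows "\<bar>f x - f y\<bar> \<le> C"
proof (cases "x = y")
  case False
  define p where "p = power_enat g (separation_time T xi x y)"
  have "p \<le> 1" unfolding p_def using g by (rule power_enat_le_1)
  then have "ennreal \<bar>f x - f y\<bar> \<le> ennreal \<bar>f x - f y\<bar> / p"
    by (rule ennreal_le_divide) simp
  also have "\<dots> \<le> hoelder_seminorm T xi W g f"
    unfolding hoelder_seminorm_def p_def by (rule SUP_upper2[of "(x, y)"]) (use x y False in auto)
  also note f
  finally show ?thesis using C by simp
qed (use C in simp)

text \<open>
  The density is at least \<open>exp (- Cr)\<close> off \<open>S_inf\<close>: a smaller value at one point would bound the
  density strictly below 1 almost everywhere on \<open>W\<close>, although \<open>W\<close> has length at most 1 and mass 1.
\<close>
lemma standard_pair_measure_ge: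
  assumes S: "S_inf T xi \<in> null_sets lborel"
    and g: "0 \<le> g" "g \<le> 1" and Cr: "0 \<le> Cr"
    and pair: "standard_pair T xi g Cr W \<nu>"
    and V: "V \<in> sets borel" "V \<subseteq> W"
  shows "exp (- Cr) * len V \<le> measure \<nu> V"
proof -
  obtain \<rho> where \<rho>[measurable]: "\<rho> \<in> borel_measurable borel"
    and \<nu>: "\<nu> = density lborel (\<lambda>x. ennreal (\<rho> x))"
    and nonneg: "\<And>x. 0 \<le> \<rho> x" and pos: "\<And>x. x \<in> W \<Longrightarrow> 0 < \<rho> x"
    and norm: "hoelder_seminorm T xi W g (\<lambda>x. indicator W x * ln (\<rho> x)) \<le> ennreal Cr"
    using pair unfolding standard_pair_def by blast
  have sub: "subinterval W" and prob: "prob_space \<nu>" and out: "emeasure \<nu> (- W) = 0"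
    using pair unfolding standard_pair_def is_pair_def by blast+
  interpret prob_space \<nu> by (rule prob)
  have W[measurable]: "W \<in> sets borel"
    using sub real_interval_borel_measurable unfolding subinterval_def by blast
  note V(1)[measurable]
  have null: "AE x in lborel. x \<notin> S_inf T xi" using S by (rule AE_not_in)
  have compare: "\<rho> y \<le> exp Cr * \<rho> x"
    if x: "x \<in> W - S_inf T xi" and y: "y \<in> W - S_inf T xi" for x y
  proof -
    have "ln (\<rho> y) \<le> Cr + ln (\<rho> x)"
      using hoelder_seminorm_oscillation[OF g Cr norm y x] x y by auto
    then have "exp (ln (\<rho> y)) \<le> exp (Cr + ln (\<rho> x))" by simp
    then show ?thesis using pos x y by (simp add: exp_add)
  qed
  have lower: "exp (- Cr) \<le> \<rho> x" if x: "x \<in> W - S_inf T xi" for x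
  proof -
    have "1 = emeasure \<nu> (space \<nu>)" using emeasure_space_1 by simp
    also have "space \<nu> = W \<union> - W" by (simp add: \<nu>)
    also have "emeasure \<nu> \<dots> \<le> emeasure \<nu> W + emeasure \<nu> (- W)"
      by (rule emeasure_subadditive) (auto simp: \<nu>)
    also have "\<dots> = (\<integral>\<^sup>+y. ennreal (\<rho> y) * indicator W y \<partial>lborel)"
      unfolding out by (simp add: \<nu> emeasure_density)
    also have "\<dots> \<le> (\<integral>\<^sup>+y. ennreal (exp Cr * \<rho> x) * indicator W y \<partial>lborel)"
      by (rule nn_integral_mono_AE, use null in eventually_elim)
        (use compare[OF x] in \<open>auto simp: indicator_def ennreal_leI\<close>)
    also have "\<dots> = ennreal (exp Cr * \<rho> x * len W)"
      using nonneg by (simp add: nn_integral_cmult_indicator subinterval_emeasure[OF sub] ennreal_mult)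
    finally have "1 \<le> exp Cr * \<rho> x * len W"
      by (metis ennreal_1 ennreal_le_iff2 not_one_le_zero)
    also have "\<dots> \<le> exp Cr * \<rho> x"
      using subinterval_emeasure(2)[OF sub] nonneg by (simp add: mult_left_le)
    finally show ?thesis
      by (simp add: exp_minus field_simps)
  qed
  have "emeasure lborel V \<le> emeasure lborel W" by (rule emeasure_mono) (use V in auto)
  then have finV: "emeasure lborel V = ennreal (len V)"
    unfolding subinterval_emeasure[OF sub]
    by (intro emeasure_eq_ennreal_measure) (auto simp: top_unique)
  have "ennreal (exp (- Cr) * len V) = (\<integral>\<^sup>+y. ennreal (exp (- Cr)) * indicator V y \<partial>lborel)"
    using V by (simp add: nn_integral_cmult_indicator finV ennreal_mult)
  also have "\<dots> \<le> (\<integral>\<^sup>+y. ennreal (\<rho> y) * indicator V y \<partial>lborel)"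
    by (rule nn_integral_mono_AE, use null in eventually_elim)
      (use lower V(2) in \<open>auto simp: indicator_def intro!: ennreal_leI\<close>)
  also have "\<dots> = emeasure \<nu> V" by (simp add: \<nu> emeasure_density)
  finally show ?thesis by (simp add: emeasure_eq_measure)
qed

section \<open>Long intervals\<close>

lemma half_weight_long:
  assumes Cp: "0 < Cp" and q0: "0 < q0"
    and nonneg: "\<And>i. i \<in> fam_index G \<Longrightarrow> 0 \<le> fam_weight G i"
    and sub: "\<And>i. i \<in> fam_index G \<Longrightarrow> subinterval (fam_interval G i)"
    and sum: "(fam_weight G has_sum 1) (fam_index G)"
    and proper: "proper_family q0 Cp G"
  defines "L \<equiv> {i \<in> fam_index G. (2 * Cp) powr (- 1 / q0) \<le> len (fam_interval G i)}"
  shows "1 / 2 \<le> infsum (fam_weight G) L"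
proof -
  define K where "K = fam_index G - L"
  have LK: "L \<union> K = fam_index G" "L \<inter> K = {}" unfolding K_def L_def by auto
  have summ: "fam_weight G summable_on fam_index G"
    using sum summable_on_def by blast
  have summL: "fam_weight G summable_on L" and summK: "fam_weight G summable_on K"
    using summ summable_on_subset_banach LK(1) by blast+
  have "infsum (fam_weight G) K \<le> 1 / 2"
  proof (rule infsum_le_finite_sums[OF summK])
    fix F assume F: "finite F" "F \<subseteq> K"
    have FG: "F \<subseteq> fam_index G" using F LK by blast
    let ?t = "\<lambda>i. fam_weight G i * len (fam_interval G i) powr (- q0)"
    have "2 * Cp * fam_weight G i \<le> ?t i" if "i \<in> F" for i
    proof -
      have i: "i \<in> fam_index G" using that FG by blast
      have "0 < len (fam_interval G i)" using sub[OF i] unfolding subinterval_def by blast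
      moreover have "len (fam_interval G i) \<le> (2 * Cp) powr (- 1 / q0)"
        using that F unfolding K_def L_def by auto
      ultimately have "((2 * Cp) powr (- 1 / q0)) powr (- q0) \<le> len (fam_interval G i) powr (- q0)"
        using q0 by (intro powr_mono2') auto
      moreover have "((2 * Cp) powr (- 1 / q0)) powr (- q0) = 2 * Cp"
        using q0 Cp by (simp add: powr_powr)
      ultimately show ?thesis
        using nonneg[OF i] by (simp add: mult_left_mono mult.commute)
    qed
    then have "2 * Cp * sum (fam_weight G) F \<le> sum ?t F"
      by (simp add: sum_distrib_left sum_mono)
    also have "sum ?t F \<le> Cp"
    proof -
      have "ennreal (sum ?t F) = (\<Sum>i\<in>F. ennreal (?t i))"
        using nonneg FG by (intro sum_ennreal[symmetric]) auto
      also have "\<dots> = (\<Sum>\<^sub>\<infinity>i\<in>F. ennreal (?t i))" using F by simp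
      also have "\<dots> \<le> Z_family q0 G"
        unfolding Z_family_def
        by (rule infsum_mono_neutral) (use FG in \<open>auto intro: nonneg_summable_on_complete\<close>)
      also have "\<dots> \<le> ennreal Cp" using proper unfolding proper_family_def .
      finally show ?thesis using Cp by simp
    qed
    finally show "sum (fam_weight G) F \<le> 1 / 2" using Cp by simp
  qed
  moreover have "infsum (fam_weight G) L + infsum (fam_weight G) K = 1"
    using infsum_Un_disjoint[OF summL summK LK(2)] infsumI[OF sum] LK(1) by simp
  ultimately show ?thesis by linarith
qed

lemma interval_contains_grid_cell:
  fixes W :: "real set"
  assumes W: "subinterval W" and N: "2 / real N < len W" "0 < N"
  obtains j where "j < N" "{real j / N .. (real j + 1) / N} \<subseteq> W"
proof -
  have W01: "W \<subseteq> {0..1}" and int: "is_interval W" and pos: "0 < len W"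
    using W unfolding subinterval_def by blast+
  have ne: "W \<noteq> {}" using pos by auto
  have bdd: "bdd_below W" "bdd_above W"
    using W01 by (meson bdd_below_Icc bdd_below_mono bdd_above_Icc bdd_above_mono)+
  have Inf0: "0 \<le> Inf W" using ne W01 by (intro cInf_greatest) auto
  have Sup1: "Sup W \<le> 1" using ne W01 by (intro cSup_least) auto
  have IS: "Inf W \<le> Sup W" using ne bdd by (intro cInf_le_cSup)
  have "W \<subseteq> {Inf W..Sup W}" using bdd by (auto intro: cInf_lower cSup_upper)
  then have "len W \<le> len {Inf W..Sup W}"
    using real_interval_borel_measurable[OF int]
    by (intro measure_mono_fmeasurable) (auto intro!: fmeasurableI simp: emeasure_lborel_Icc_eq)
  then have gap: "2 / N < Sup W - Inf W" using N IS by simp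
  \<comment> \<open>The first grid point strictly to the right of \<open>Inf W\<close>, as \<open>W\<close> need not contain its endpoints.\<close>
  define j where "j = nat \<lfloor>Inf W * N\<rfloor> + 1"
  have "real j = of_int \<lfloor>Inf W * N\<rfloor> + 1" unfolding j_def using Inf0 by simp
  then have "Inf W * N < j" "real j \<le> Inf W * N + 1" by linarith+
  then have jlo: "Inf W < real j / N" and "(real j + 1) / N \<le> (Inf W * N + 2) / N"
    using N by (simp_all add: pos_less_divide_eq divide_right_mono)
  then have "(real j + 1) / N \<le> Inf W + 2 / N"
    using N by (simp add: add_divide_distrib)
  then have jhi: "(real j + 1) / N < Sup W" using gap by linarith
  obtain x where x: "x \<in> W" "x < real j / N"
    using jlo cInf_less_iff[OF ne bdd(1)] by blast
  obtain y where y: "y \<in> W" "(real j + 1) / N < y"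
    using jhi less_cSup_iff[OF ne bdd(2)] by blast
  have "{real j / N .. (real j + 1) / N} \<subseteq> W"
  proof
    fix z assume "z \<in> {real j / N .. (real j + 1) / N}"
    then have "x \<le> z" "z \<le> y" using x y by auto
    then show "z \<in> W" using int x y unfolding is_interval_1 by blast
  qed
  moreover have "(real j + 1) / N < 1" using jhi Sup1 by linarith
  then have "j < N" using N by (simp add: field_simps)
  ultimately show ?thesis using that by blast
qed

lemma piece_superset:
  assumes map: "piecewise_monotone_map T xi"
    and I: "subinterval I" and W: "subinterval W" and IW: "I \<subseteq> W"
    and V: "V \<in> pieces T xi n I"
  obtains V' where "V' \<in> pieces T xi n W" "V \<subseteq> V'"
proof -
  obtain A where A: "A \<in> xi_join T xi n" "V = I \<inter> A" "0 < len V"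
    using V unfolding pieces_def by blast
  have "W \<inter> A \<in> sets borel"
    using real_interval_borel_measurable almost_interval_borel almost_interval_xi_join[OF map A(1)] W
    unfolding subinterval_def by blast
  moreover have "V \<in> sets borel"
    using pieces_borel[OF map _ V] I unfolding subinterval_def by blast
  moreover have "emeasure lborel (W \<inter> A) \<le> emeasure lborel {0..1::real}"
    using W unfolding subinterval_def by (intro emeasure_mono) auto
  then have "emeasure lborel (W \<inter> A) < \<infinity>"
    by (simp add: order.strict_trans1)
  ultimately have "len V \<le> len (W \<inter> A)"
    using A(2) IW by (intro measure_mono_fmeasurable) (auto intro: fmeasurableI)
  then have "W \<inter> A \<in> pieces T xi n W" using A unfolding pieces_def by auto
  then show ?thesis using that A(2) IW by blast
qed

section \<open>The covering ratio\<close>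

text \<open>
  An infinite sum of reals that does not converge has the value 0, so lower bounds for a covering
  ratio require summability.
\<close>
lemma iterate_family_weight_summable:
  assumes map: "piecewise_monotone_map T xi"
    and fam: "standard_family T xi g Cr G"
  shows "fam_weight (iterate_family T xi n G) summable_on fam_index (iterate_family T xi n G)"
proof -
  let ?P = "\<lambda>i. pieces T xi n (fam_interval G i)"
  let ?\<nu> = "fam_measure G"
  have weight: "0 \<le> fam_weight G i" if "i \<in> fam_index G" for i
    using fam that unfolding standard_family_def by blast
  have sum: "fam_weight G summable_on fam_index G"
    using fam unfolding standard_family_def summable_on_def by blast
  have fin: "sum (measure (?\<nu> i)) F \<le> 1" if i: "i \<in> fam_index G" and F: "finite F" "F \<subseteq> ?P i" for i F
  proof -
    have pair: "is_pair (fam_interval G i) (?\<nu> i)"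
      using fam i unfolding standard_family_def standard_pair_def by blast
    then interpret prob_space "?\<nu> i" unfolding is_pair_def by blast
    have "disjoint xi"
      using map unfolding piecewise_monotone_map_def partition_on_def by blast
    then have "disjoint (?P i)" by (rule disjoint_pieces)
    then have "disjoint_family_on id F"
      using F(2) unfolding disjoint_family_on_def disjoint_def by auto
    moreover have "V \<in> sets (?\<nu> i)" if "V \<in> F" for V
      using pieces_borel[OF map, of "fam_interval G i" V n] pair that F(2)
      unfolding is_pair_def subinterval_def by auto
    ultimately have "sum (measure (?\<nu> i)) F = measure (?\<nu> i) (\<Union>V\<in>F. id V)"
      using F(1) by (subst finite_measure_finite_Union) auto
    then show ?thesis by simp
  qed
  have pieces_summable: "measure (?\<nu> i) summable_on ?P i" if "i \<in> fam_index G" for i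
    using fin[OF that] by (intro nonneg_bdd_above_summable_on) (auto simp: bdd_above_def)
  have pieces_le: "infsum (measure (?\<nu> i)) (?P i) \<le> 1" if "i \<in> fam_index G" for i
    using pieces_summable[OF that] fin[OF that] by (rule infsum_le_finite_sums)
  have "(\<lambda>(i, V). fam_weight G i * measure (?\<nu> i) V) summable_on (SIGMA i:fam_index G. ?P i)"
  proof (rule summable_on_SigmaI)
    show "((\<lambda>V. case (i, V) of (i, V) \<Rightarrow> fam_weight G i * measure (?\<nu> i) V) has_sum
        fam_weight G i * infsum (measure (?\<nu> i)) (?P i)) (?P i)" if "i \<in> fam_index G" for i
      using has_sum_cmult_right[OF has_sum_infsum[OF pieces_summable[OF that]]] by simp
    show "(\<lambda>i. fam_weight G i * infsum (measure (?\<nu> i)) (?P i)) summable_on fam_index G"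
    proof (rule summable_on_comparison_test[OF sum])
      fix i assume i: "i \<in> fam_index G"
      show "fam_weight G i * infsum (measure (?\<nu> i)) (?P i) \<le> fam_weight G i"
        using weight[OF i] pieces_le[OF i] by (simp add: mult_left_le)
      show "0 \<le> fam_weight G i * infsum (measure (?\<nu> i)) (?P i)"
        using weight[OF i] by (simp add: infsum_nonneg)
    qed
  qed (use weight in auto)
  then show ?thesis by (simp add: iterate_family_def)
qed

lemma covering_ratio_iterate_ge:
  assumes map: "piecewise_monotone_map T xi"
    and fam: "standard_family T xi g Cr G"
    and c: "0 \<le> c"
    and L: "L \<subseteq> fam_index G"
    and cover: "\<And>i. i \<in> L \<Longrightarrow> \<exists>V\<in>pieces T xi n (fam_interval G i).
                    U \<subseteq> (T ^^ n) ` V \<and> c \<le> measure (fam_measure G i) V"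
  shows "c * infsum (fam_weight G) L \<le> covering_ratio U (iterate_family T xi n G)"
proof -
  let ?H = "iterate_family T xi n G"
  let ?D = "{k \<in> fam_index ?H. U \<subseteq> fam_interval ?H k}"
  obtain V where V: "\<And>i. i \<in> L \<Longrightarrow> V i \<in> pieces T xi n (fam_interval G i)"
      "\<And>i. i \<in> L \<Longrightarrow> U \<subseteq> (T ^^ n) ` V i"
      "\<And>i. i \<in> L \<Longrightarrow> c \<le> measure (fam_measure G i) (V i)"
    using cover by metis
  \<comment> \<open>One covering component for each member of \<open>L\<close>; they have distinct indices in the iterate.\<close>
  let ?h = "\<lambda>i. (i, V i)"
  have weight: "0 \<le> fam_weight G i" if "i \<in> fam_index G" for i
    using fam that unfolding standard_family_def by blast
  have inj: "inj_on ?h L" by (simp add: inj_on_def)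
  have hD: "?h ` L \<subseteq> ?D"
    using V L by (auto simp: iterate_family_def)
  have summ: "fam_weight ?H summable_on ?D"
    using iterate_family_weight_summable[OF map fam] by (rule summable_on_subset_banach) auto
  have summh: "fam_weight ?H summable_on ?h ` L"
    using summ hD by (rule summable_on_subset_banach)
  have "fam_weight G summable_on L"
    using fam L summable_on_subset_banach unfolding standard_family_def summable_on_def by blast
  then have summL: "(\<lambda>i. c * fam_weight G i) summable_on L"
    by (rule summable_on_cmult_right)
  have "c * infsum (fam_weight G) L = (\<Sum>\<^sub>\<infinity>i\<in>L. c * fam_weight G i)"
    by (simp add: infsum_cmult_right')
  also have "\<dots> \<le> infsum (fam_weight ?H \<circ> ?h) L"
    using summL summh[unfolded summable_on_reindex[OF inj]]
  proof (rule infsum_mono)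
    fix i assume i: "i \<in> L"
    show "c * fam_weight G i \<le> (fam_weight ?H \<circ> ?h) i"
      using V(3)[OF i] weight i L
      by (auto simp: iterate_family_def mult.commute[of c] intro!: mult_left_mono)
  qed
  also have "\<dots> = infsum (fam_weight ?H) (?h ` L)"
    by (rule infsum_reindex[OF inj, symmetric])
  also have "\<dots> \<le> infsum (fam_weight ?H) ?D"
    by (rule infsum_mono_neutral[OF summh summ]) (use hD weight in \<open>auto simp: iterate_family_def\<close>)
  finally show ?thesis unfolding covering_ratio_def .
qed

theorem lemma4p2:
  fixes T :: "real \<Rightarrow> real" and xi :: "real set set" and U :: "real set"
    and CJ gJ g Cr q0 \<delta>0 Cp :: real
  assumes map: "piecewise_monotone_map T xi"
    and H1: "\<exists>q\<in>{0<..1}. one_step_expansion T xi q"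
    and H2: "regular_log_derivative T xi CJ gJ"
    and H3: "magnet T xi U"
    and g: "gJ \<le> g" "g < 1"
    and Cr: "Cr \<ge> max 1 (2 * CJ / (inverse g - 1))"
    and q0: "0 < q0" "q0 < q_bar T xi"
    and \<delta>0: "0 < \<delta>0" "expansion_sup T xi q0 \<delta>0 < 1"
    and Cp: "Cp \<ge> 10 * c0 T xi q0 \<delta>0 * exp (7 * Cr)"
  shows "\<exists>(n_c :: nat) (d_c :: real).
           int n_c \<ge> n_p T xi q0 \<delta>0 Cp \<and> 0 < d_c \<and> d_c < 1 \<and>
           (\<forall>G :: nat family.
              standard_family T xi g Cr G \<and> proper_family q0 Cp G \<longrightarrow>
              covering_ratio U (iterate_family T xi n_c G) \<ge> d_c)"
proof -
  have g01: "0 \<le> g" "g \<le> 1" using g H2 unfolding regular_log_derivative_def by auto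
  have Cr0: "0 \<le> Cr" using Cr by simp
  have "1 \<le> c0 T xi q0 \<delta>0" unfolding c0_def by simp
  then have "0 < 10 * c0 T xi q0 \<delta>0 * exp (7 * Cr)" by simp
  then have Cp0: "0 < Cp" using Cp by linarith
  have S: "S_inf T xi \<in> null_sets lborel"
    using countable_S_inf[OF map] by (rule countable_imp_null_set_lborel)
  define \<epsilon> where "\<epsilon> = (2 * Cp) powr (- 1 / q0)"
  have \<epsilon>: "0 < \<epsilon>" unfolding \<epsilon>_def using Cp0 by simp
  then obtain N where N: "2 / \<epsilon> < real N" using reals_Archimedean2 by blast
  have N0: "0 < N" using N \<epsilon> by (cases N) (auto simp: field_simps)
  have N\<epsilon>: "2 / real N < \<epsilon>" using N N0 \<epsilon> by (simp add: field_simps)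
  define I where "I j = {real j / N .. (real j + 1) / N}" for j
  have I: "subinterval (I j)" if "j < N" for j
    using that N0 unfolding subinterval_def I_def by (auto simp: field_simps is_interval_cc)
  have "\<exists>m. \<forall>n\<ge>m. \<exists>V\<in>pieces T xi n (I j). U \<subseteq> (T ^^ n) ` V" if "j < N" for j
    using H3 I[OF that] unfolding magnet_def by blast
  then obtain m where m: "\<And>j n. j < N \<Longrightarrow> m j \<le> n \<Longrightarrow> \<exists>V\<in>pieces T xi n (I j). U \<subseteq> (T ^^ n) ` V"
    by metis
  define n where "n = max (nat (n_p T xi q0 \<delta>0 Cp)) (Max (m ` {..<N}))"
  have "m j \<le> n" if "j < N" for j
    unfolding n_def using that by (intro max.coboundedI2 Max_ge) auto
  then have "\<forall>j\<in>{..<N}. \<exists>V\<in>pieces T xi n (I j). U \<subseteq> (T ^^ n) ` V"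
    using m by blast
  then obtain V where V: "\<And>j. j < N \<Longrightarrow> V j \<in> pieces T xi n (I j)"
      "\<And>j. j < N \<Longrightarrow> U \<subseteq> (T ^^ n) ` V j"
    by (metis lessThan_iff)
  have Vpos: "0 < len (V j)" if "j < N" for j
    using V(1)[OF that] unfolding pieces_def by auto
  define v where "v = Min (insert 1 ((\<lambda>j. len (V j)) ` {..<N}))"
  have v: "0 < v" "v \<le> 1" "\<And>j. j < N \<Longrightarrow> v \<le> len (V j)"
    unfolding v_def using Vpos by auto
  define c where "c = exp (- Cr) * v"
  have "exp (- Cr) \<le> 1" using Cr0 by simp
  then have c: "0 < c" "c \<le> 1" unfolding c_def using v by (auto intro: mult_le_one)
  have "c / 2 \<le> covering_ratio U (iterate_family T xi n G)"
    if fam: "standard_family T xi g Cr G" and proper: "proper_family q0 Cp G" for G :: "nat family"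
  proof -
    define L where "L = {i \<in> fam_index G. \<epsilon> \<le> len (fam_interval G i)}"
    have pair: "standard_pair T xi g Cr (fam_interval G i) (fam_measure G i)"
      and weight: "0 \<le> fam_weight G i" if "i \<in> fam_index G" for i
      using fam that unfolding standard_family_def by blast+
    have sub: "subinterval (fam_interval G i)" if "i \<in> fam_index G" for i
      using pair[OF that] unfolding standard_pair_def is_pair_def by blast
    have half: "1 / 2 \<le> infsum (fam_weight G) L"
      unfolding L_def \<epsilon>_def
      using half_weight_long[OF Cp0 q0(1) weight sub _ proper] fam
      unfolding standard_family_def by blast
    have "\<exists>V'\<in>pieces T xi n (fam_interval G i).
        U \<subseteq> (T ^^ n) ` V' \<and> c \<le> measure (fam_measure G i) V'" if "i \<in> L" for i
    proof -
      let ?W = "fam_interval G i"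
      have i: "i \<in> fam_index G" and long: "2 / real N < len ?W"
        using that N\<epsilon> unfolding L_def by auto
      obtain j where j: "j < N" "I j \<subseteq> ?W"
        using interval_contains_grid_cell[OF sub[OF i] long N0] unfolding I_def by blast
      obtain V' where V': "V' \<in> pieces T xi n ?W" "V j \<subseteq> V'"
        using piece_superset[OF map I[OF j(1)] sub[OF i] j(2) V(1)[OF j(1)]] .
      have borel: "V j \<in> sets borel" "V' \<in> sets borel"
        using pieces_borel[OF map] V(1)[OF j(1)] V'(1) I[OF j(1)] sub[OF i]
        unfolding subinterval_def by blast+
      have VW: "V j \<subseteq> ?W" using V(1)[OF j(1)] j(2) unfolding pieces_def by blast
      interpret prob_space "fam_measure G i"
        using pair[OF i] unfolding standard_pair_def is_pair_def by blast
      have sets: "sets (fam_measure G i) = sets borel"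
        using pair[OF i] unfolding standard_pair_def is_pair_def by blast
      have "c \<le> exp (- Cr) * len (V j)" unfolding c_def using v(3)[OF j(1)] by simp
      also have "\<dots> \<le> measure (fam_measure G i) (V j)"
        using standard_pair_measure_ge[OF S g01 Cr0 pair[OF i] borel(1) VW] .
      also have "\<dots> \<le> measure (fam_measure G i) V'"
        using V'(2) borel(2) sets by (intro finite_measure_mono) auto
      finally show ?thesis using V' V(2)[OF j(1)] by blast
    qed
    then have "c * infsum (fam_weight G) L \<le> covering_ratio U (iterate_family T xi n G)"
      using c by (intro covering_ratio_iterate_ge[OF map fam]) (auto simp: L_def)
    moreover have "c * (1 / 2) \<le> c * infsum (fam_weight G) L"
      using half c by (intro mult_left_mono) auto
    ultimately show ?thesis by simp
  qed
  moreover have "n_p T xi q0 \<delta>0 Cp \<le> int n" unfolding n_def by linarith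
  ultimately show ?thesis
    using c by (intro exI[of _ n] exI[of _ "c / 2"]) auto
qed

end
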